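(* Let $\mathcal{G}=(\mathcal{V},\mathcal{E})$ be an undirected graph with $\mathcal{V}=\{1,\dots,N\}$ and neighbor sets $\mathcal{N}_i$, let $f_i:\mathbb{R}^{n(|\mathcal{N}_i|+1)}\to\mathbb{R}\cup\{+\infty\}$, $i\in\mathcal{V}$, be closed, proper and convex, let $\rho>0$ be the penalty parameter and $\alpha$ the relaxation parameter of the R-ADMM algorithm. Consider the problem $$\min_{\mathbf{x},\mathbf{y}}\{f(\mathbf{x})+\iota_{(I-P)}(\mathbf{y})\}\quad\text{s.t. } A\mathbf{x}+\mathbf{y}=0$$ with $f,\iota_{(I-P)},A,P$ as in the context. The trajectories generated by the variables $\mathbf{x}^{(i)}$, $i\in\mathcal{V}$, obtained by applying the R-ADMM algorithm (see context) to this problem, starting from a given initial condition $\mathbf{x}^{(i)}(0),\mathbf{w}^{(i)}(0),\mathbf{y}^{(i)}(0)$, are identical to the trajectories generated by iterating the following equations: $$\mathbf{x}^{(i)}(k)=\arg\min_{x_i^{(i)},\{x_j^{(i)}\}_{j\in\mathcal{N}_i}}\Big\{f_i\big(x_i^{(i)},\{x_j^{(i)}\}_{j\in\mathcal{N}_i}\big)-\Big(\sum_{j\in\mathcal{N}_i}z_i^{(j,i)}(k)\Big)^{\top}x_i^{(i)}-\sum_{j\in\mathcal{N}_i}z_j^{(j,i)}(k)^{\top}x_j^{(i)}+\frac{\rho}{2}|\mathcal{N}_i|\,\|x_i^{(i)}\|^2+\frac{\rho}{2}\sum_{j\in\mathcal{N}_i}\|x_j^{(i)}\|^2\Big\}$$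 for all $i\in\mathcal{V}$, and $$z_i^{(i,j)}(k+1)=(1-\alpha)z_i^{(i,j)}(k)-\alpha z_i^{(j,i)}(k)+2\alpha\rho\,x_i^{(i)}(k),$$ $$z_j^{(i,j)}(k+1)=(1-\alpha)z_j^{(i,j)}(k)-\alpha z_j^{(j,i)}(k)+2\alpha\rho\,x_j^{(i)}(k)$$ for all $i\in\mathcal{V}$ and $j\in\mathcal{N}_i$, where the auxiliary variables are initialized as $z_l^{(i,j)}(0)=w_l^{(i,j)}(0)+\rho\,y_l^{(i,j)}(0)$ for all $i\in\mathcal{V}$, $j\in\mathcal{N}_i$, $l\in\{i,j\}$.
   Context: Here $\mathcal{N}_i=\{j\in\mathcal{V}:(i,j)\in\mathcal{E}\}$. A function $h$ with values in $\mathbb{R}\cup\{+\infty\}$ is closed if for every $a\in\mathbb{R}$ the set $\{x\in\operatorname{dom}(h): h(x)\le a\}$ is closed, and proper if it does not attain $-\infty$. The optimization problem is assumed to have a solution. Variables. Each node $i$ has local copies $x_i^{(i)}\in\mathbb{R}^n$ and $x_j^{(i)}\in\mathbb{R}^n$, $j\in\mathcal{N}_i$, collected in $\mathbf{x}^{(i)}=(x_i^{(i)},\{x_j^{(i)}\}_{j\in\mathcal{N}_i})\in\mathbb{R}^{n(|\mathcal{N}_i|+1)}$; $\mathbf{x}$ stacks all $\mathbf{x}^{(i)}$, and $f(\mathbf{x})=\sum_{i=1}^N f_i(\mathbf{x}^{(i)})$. For every $i\in\mathcal{V}$, $j\in\mathcal{N}_i$ and $l\in\{i,j\}$ there are bridge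 variables $y_l^{(i,j)}\in\mathbb{R}^n$ and Lagrange multipliers $w_l^{(i,j)}\in\mathbb{R}^n$ (associated with the constraint $x_l^{(i)}=y_l^{(i,j)}$). For each $i$, $\mathbf{y}^{(i)}$ and $\mathbf{w}^{(i)}$ collect the $y_l^{(i,j)}$ and $w_l^{(i,j)}$ with $j\in\mathcal{N}_i$, $l\in\{i,j\}$; $\mathbf{y}$ and $\mathbf{w}$ stack all $\mathbf{y}^{(i)}$ and all $\mathbf{w}^{(i)}$. The auxiliary variables $z_l^{(i,j)}\in\mathbb{R}^n$ are indexed in the same way. The matrix $A$ is such that the block of $A\mathbf{x}$ with index $(i,j),l$ is $-x_l^{(i)}$, so $A\mathbf{x}+\mathbf{y}=0$ means $x_l^{(i)}=y_l^{(i,j)}$ for all $i$, $j\in\mathcal{N}_i$, $l\in\{i,j\}$. $P$ is the permutation matrix that swaps the block $y_l^{(i,j)}$ with the block $y_l^{(j,i)}$. The indicator $\iota_{(I-P)}(\mathbf{y})$ equals $0$ if $(I-P)\mathbf{y}=0$ and $+\infty$ otherwise. R-ADMM. With augmented Lagrangian $\mathcal{L}_\rho(\mathbf{x},\mathbf{y};\mathbf{w})=f(\mathbf{x})+\iota_{(I-P)}(\mathbf{y})-\mathbf{w}^\top(A\mathbf{x}+\mathbf{y})+\frac{\rho}{2}\|A\mathbf{x}+\mathbf{y}\|^2$, the R-ADMM (relaxed alternating direction method of multipliers) applied to the problem alternates the three steps $$\mathbf{y}(k+1)=\arg\min_{\mathbf{y}}\{\mathcal{L}_\rho(\mathbf{x}(k),\mathbf{y};\mathbf{w}(k))+\rho(2\alpha-1)\langle\mathbf{y},A\mathbf{x}(k)+\mathbf{y}(k)\rangle\},$$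 $$\mathbf{w}(k+1)=\mathbf{w}(k)-\rho(A\mathbf{x}(k)+\mathbf{y}(k+1))-\rho(2\alpha-1)(A\mathbf{x}(k)+\mathbf{y}(k)),$$ $$\mathbf{x}(k+1)=\arg\min_{\mathbf{x}}\mathcal{L}_\rho(\mathbf{x},\mathbf{y}(k+1);\mathbf{w}(k+1)).$$
   Formalization: The claim fails for arbitrary initial data; it is proved assuming P y(0) = y(0), P w(0) = -w(0) and f(x(0)) < ∞ (else the first y-step has no argmin), with the x-equation imposed for k ≥ 1, or for all k ≥ 0 if x(0) minimizes L_ρ(·, y(0); w(0)). *)

theory Defs
  imports "HOL-Analysis.Analysis"
begin

text \<open>
  Vertices are the elements of a finite type \<open>'v\<close>; an undirected graph is a symmetric,
  irreflexive edge set.  Blocks live in \<open>real ^ 'n\<close>.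

  Variables whose index set depends on the graph are stored in a full array and are zero at
  the indices that do not occur:
  \<^item> \<open>u $ j\<close> is the copy of the variable of node \<open>j\<close> held by a fixed node (for \<open>u\<close> in
    \<open>local_space E i\<close>), and \<open>x $ i $ j\<close> is the copy of it held by node \<open>i\<close>;
  \<^item> \<open>y $ i $ j $ l\<close> is the block with upper index \<open>(i, j)\<close> and lower index \<open>l\<close>.

  With this zero padding the inner product and the norm of the arrays are those of the
  stacked vectors.
\<close>

type_synonym ('n, 'v) local_vec = "real ^ 'n ^ 'v"
type_synonym ('n, 'v) copies = "real ^ 'n ^ 'v ^ 'v"
type_synonym ('n, 'v) bridge = "real ^ 'n ^ 'v ^ 'v ^ 'v"

definition undirected_graph :: "('v \<times> 'v) set \<Rightarrow> bool" where
  "undirected_graph E \<longleftrightarrow> sym E \<and> irrefl E"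

definition nbrs :: "('v \<times> 'v) set \<Rightarrow> 'v \<Rightarrow> 'v set" where
  "nbrs E i = {j. (i, j) \<in> E}"

definition local_space ::
    "('v::finite \<times> 'v) set \<Rightarrow> 'v \<Rightarrow> ('n::finite, 'v) local_vec set" where
  "local_space E i = {u. \<forall>j. j \<notin> insert i (nbrs E i) \<longrightarrow> u $ j = 0}"

definition copies_space ::
    "('v::finite \<times> 'v) set \<Rightarrow> ('n::finite, 'v) copies set" where
  "copies_space E = {x. \<forall>i. x $ i \<in> local_space E i}"

definition bridge_space ::
    "('v::finite \<times> 'v) set \<Rightarrow> ('n::finite, 'v) bridge set" where
  "bridge_space E = {y. \<forall>i j l. \<not> (j \<in> nbrs E i \<and> l \<in> {i, j}) \<longrightarrow> y $ i $ j $ l = 0}"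


definition closed_fun_on :: "'a::topological_space set \<Rightarrow> ('a \<Rightarrow> ereal) \<Rightarrow> bool" where
  "closed_fun_on S h \<longleftrightarrow> (\<forall>a::real. closed {x \<in> S. h x < \<infinity> \<and> h x \<le> ereal a})"

definition proper_fun_on :: "'a set \<Rightarrow> ('a \<Rightarrow> ereal) \<Rightarrow> bool" where
  "proper_fun_on S h \<longleftrightarrow> (\<forall>x\<in>S. h x \<noteq> - \<infinity>)"

definition convex_fun_on :: "'a::real_vector set \<Rightarrow> ('a \<Rightarrow> ereal) \<Rightarrow> bool" where
  "convex_fun_on S h \<longleftrightarrow> (\<forall>x\<in>S. \<forall>y\<in>S. \<forall>t\<in>{0..1}.
     h ((1 - t) *\<^sub>R x + t *\<^sub>R y) \<le> ereal (1 - t) * h x + ereal t * h y)"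

text \<open>
  The set of all minimizers.  As usual for extended-real-valued functions it is empty when
  the function is \<open>\<infinity>\<close> on all of \<open>S\<close>.
\<close>
definition argmin_on :: "'a set \<Rightarrow> ('a \<Rightarrow> ereal) \<Rightarrow> 'a set" where
  "argmin_on S h = {x. is_arg_min h (\<lambda>u. u \<in> S) x \<and> h x < \<infinity>}"


definition A_map ::
    "('v::finite \<times> 'v) set \<Rightarrow> ('n::finite, 'v) copies \<Rightarrow> ('n, 'v) bridge" where
  "A_map E x = (\<chi> i j l. if j \<in> nbrs E i \<and> l \<in> {i, j} then - (x $ i $ l) else 0)"

definition P_map :: "('n::finite, 'v::finite) bridge \<Rightarrow> ('n, 'v) bridge" where
  "P_map y = (\<chi> i j l. y $ j $ i $ l)"

definition iota :: "('n::finite, 'v::finite) bridge \<Rightarrow> ereal" where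
  "iota y = (if y - P_map y = 0 then 0 else \<infinity>)"

definition total_cost ::
    "('v::finite \<Rightarrow> ('n::finite, 'v) local_vec \<Rightarrow> ereal) \<Rightarrow> ('n, 'v) copies \<Rightarrow> ereal" where
  "total_cost f x = (\<Sum>i\<in>UNIV. f i (x $ i))"

definition solutions ::
    "('v::finite \<times> 'v) set \<Rightarrow> ('v \<Rightarrow> ('n::finite, 'v) local_vec \<Rightarrow> ereal)
      \<Rightarrow> (('n, 'v) copies \<times> ('n, 'v) bridge) set" where
  "solutions E f =
     argmin_on {(x, y). x \<in> copies_space E \<and> y \<in> bridge_space E \<and> A_map E x + y = 0}
       (\<lambda>(x, y). total_cost f x + iota y)"

definition aug_lagrangian ::
    "('v::finite \<times> 'v) set \<Rightarrow> ('v \<Rightarrow> ('n::finite, 'v) local_vec \<Rightarrow> ereal) \<Rightarrow> real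
      \<Rightarrow> ('n, 'v) copies \<Rightarrow> ('n, 'v) bridge \<Rightarrow> ('n, 'v) bridge \<Rightarrow> ereal" where
  "aug_lagrangian E f \<rho> x y w =
     total_cost f x + iota y
       + ereal (- (w \<bullet> (A_map E x + y)) + \<rho> / 2 * (norm (A_map E x + y))\<^sup>2)"


definition radmm ::
    "('v::finite \<times> 'v) set \<Rightarrow> ('v \<Rightarrow> ('n::finite, 'v) local_vec \<Rightarrow> ereal) \<Rightarrow> real \<Rightarrow> real
      \<Rightarrow> (nat \<Rightarrow> ('n, 'v) copies) \<Rightarrow> (nat \<Rightarrow> ('n, 'v) bridge) \<Rightarrow> (nat \<Rightarrow> ('n, 'v) bridge)
      \<Rightarrow> bool" where
  "radmm E f \<rho> \<alpha> x y w \<longleftrightarrow> (\<forall>k.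
     y (Suc k) \<in> argmin_on (bridge_space E)
       (\<lambda>v. aug_lagrangian E f \<rho> (x k) v (w k)
             + ereal (\<rho> * (2 * \<alpha> - 1) * (v \<bullet> (A_map E (x k) + y k)))) \<and>
     w (Suc k) = w k - \<rho> *\<^sub>R (A_map E (x k) + y (Suc k))
                   - (\<rho> * (2 * \<alpha> - 1)) *\<^sub>R (A_map E (x k) + y k) \<and>
     x (Suc k) \<in> argmin_on (copies_space E)
       (\<lambda>u. aug_lagrangian E f \<rho> u (y (Suc k)) (w (Suc k))))"

text \<open>
  Trajectories form a set because a minimization step can have several minimizers or none
  (for instance at an isolated node, where no quadratic term is present).
\<close>
definition radmm_trajectories ::
    "('v::finite \<times> 'v) set \<Rightarrow> ('v \<Rightarrow> ('n::finite, 'v) local_vec \<Rightarrow> ereal) \<Rightarrow> real \<Rightarrow> real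
      \<Rightarrow> ('n, 'v) copies \<Rightarrow> ('n, 'v) bridge \<Rightarrow> ('n, 'v) bridge
      \<Rightarrow> (nat \<Rightarrow> ('n, 'v) copies) set" where
  "radmm_trajectories E f \<rho> \<alpha> x0 w0 y0 =
     {x. \<exists>y w. x 0 = x0 \<and> w 0 = w0 \<and> y 0 = y0 \<and> radmm E f \<rho> \<alpha> x y w}"


definition local_objective ::
    "('v::finite \<times> 'v) set \<Rightarrow> ('v \<Rightarrow> ('n::finite, 'v) local_vec \<Rightarrow> ereal) \<Rightarrow> real
      \<Rightarrow> ('n, 'v) bridge \<Rightarrow> 'v \<Rightarrow> ('n, 'v) local_vec \<Rightarrow> ereal" where
  "local_objective E f \<rho> z i u =
     f i u + ereal (
       - ((\<Sum>j\<in>nbrs E i. z $ j $ i $ i) \<bullet> (u $ i))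
       - (\<Sum>j\<in>nbrs E i. (z $ j $ i $ j) \<bullet> (u $ j))
       + \<rho> / 2 * real (card (nbrs E i)) * (norm (u $ i))\<^sup>2
       + \<rho> / 2 * (\<Sum>j\<in>nbrs E i. (norm (u $ j))\<^sup>2))"

definition local_x_update ::
    "('v::finite \<times> 'v) set \<Rightarrow> ('v \<Rightarrow> ('n::finite, 'v) local_vec \<Rightarrow> ereal) \<Rightarrow> real
      \<Rightarrow> ('n, 'v) bridge \<Rightarrow> ('n, 'v) copies \<Rightarrow> bool" where
  "local_x_update E f \<rho> z x \<longleftrightarrow>
     (\<forall>i. x $ i \<in> argmin_on (local_space E i) (local_objective E f \<rho> z i))"

definition z_update ::
    "('v::finite \<times> 'v) set \<Rightarrow> real \<Rightarrow> real \<Rightarrow> ('n::finite, 'v) copies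
      \<Rightarrow> ('n, 'v) bridge \<Rightarrow> ('n, 'v) bridge \<Rightarrow> bool" where
  "z_update E \<rho> \<alpha> x z z' \<longleftrightarrow> (\<forall>i. \<forall>j\<in>nbrs E i.
     z' $ i $ j $ i =
       (1 - \<alpha>) *\<^sub>R (z $ i $ j $ i) - \<alpha> *\<^sub>R (z $ j $ i $ i) + (2 * \<alpha> * \<rho>) *\<^sub>R (x $ i $ i) \<and>
     z' $ i $ j $ j =
       (1 - \<alpha>) *\<^sub>R (z $ i $ j $ j) - \<alpha> *\<^sub>R (z $ j $ i $ j) + (2 * \<alpha> * \<rho>) *\<^sub>R (x $ i $ j))"

text \<open>
  Trajectories of the node-based iteration.  The parameter \<open>m\<close> is the first time at which the
  minimization equation is imposed: for \<open>m = 0\<close> it is imposed at every time, for \<open>m = 1\<close> the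
  state at time \<open>0\<close> is just the prescribed initial state.
\<close>
definition node_trajectories ::
    "nat \<Rightarrow> ('v::finite \<times> 'v) set \<Rightarrow> ('v \<Rightarrow> ('n::finite, 'v) local_vec \<Rightarrow> ereal)
      \<Rightarrow> real \<Rightarrow> real \<Rightarrow> ('n, 'v) copies \<Rightarrow> ('n, 'v) bridge \<Rightarrow> ('n, 'v) bridge
      \<Rightarrow> (nat \<Rightarrow> ('n, 'v) copies) set" where
  "node_trajectories m E f \<rho> \<alpha> x0 w0 y0 =
     {x. \<exists>z. x 0 = x0 \<and> (\<forall>k. z k \<in> bridge_space E) \<and>
         (\<forall>i. \<forall>j\<in>nbrs E i. \<forall>l\<in>{i, j}.
            z 0 $ i $ j $ l = w0 $ i $ j $ l + \<rho> *\<^sub>R (y0 $ i $ j $ l)) \<and>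
         (\<forall>k\<ge>m. local_x_update E f \<rho> (z k) (x k)) \<and>
         (\<forall>k. z_update E \<rho> \<alpha> (x k) (z k) (z (Suc k)))}"

text \<open>
  For arbitrary initial data the two iterations can differ already at time 1.  After one step of
  the R-ADMM, \<open>P y = y\<close> and \<open>P w = - w\<close> always hold (\<open>\<rho> y\<close> is the projection of a vector
  \<open>z\<close> onto the kernel of \<open>I - P\<close> and \<open>w\<close> is the remainder \<open>z - \<rho> y\<close>), and it is under
  these relations that \<open>z = w + \<rho> y\<close> determines \<open>y\<close> and \<open>w\<close>.  The initial data have to
  satisfy them too.  Moreover \<open>total_cost f x0\<close> has to be finite, because it is a summand of
  the objective of the first \<open>y\<close>-step, which would otherwise be \<open>\<infinity>\<close> everywhere.
\<close>

end

theory Submission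
  imports Defs
begin

text \<open>
  The two iterations are the same dynamical system in different coordinates. Write \<open>P\<close> for the
  swap \<open>P_map\<close>, a self-adjoint involution, and put \<open>z = w + \<rho> y\<close>. When \<open>P y = y\<close> and
  \<open>P w = - w\<close>, the vectors \<open>\<rho> y\<close> and \<open>w\<close> are the two orthogonal components
  \<open>(z + P z) / 2\<close> and \<open>(z - P z) / 2\<close> of \<open>z\<close>, so \<open>(y, w)\<close> and \<open>z\<close> carry the same
  information (\<open>bridge_of\<close>, \<open>multiplier_of\<close>).

  In these coordinates the \<open>y\<close>-step minimizes a strictly convex quadratic over the fixed space
  of \<open>P\<close>. Completing the square shows that \<open>\<rho> y'\<close> is the symmetric component of the vector
  \<open>g = w - \<rho> A x - \<rho> (2 \<alpha> - 1) (A x + y)\<close>, and the multiplier step leaves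
  exactly the remaining component of \<open>g\<close> in \<open>w'\<close>. Hence \<open>z' = g\<close>, which is the
  affine update of the auxiliary variables (\<open>radmm_yw_step\<close>).

  In the \<open>x\<close>-step, apart from \<open>f\<close> itself, only the terms \<open>(\<rho> y - w) \<bullet> A x + \<rho>/2 \<parallel>A x\<parallel>\<^sup>2\<close> depend on \<open>x\<close>, and
  \<open>\<rho> y - w = P z\<close>. Since \<open>A\<close> only copies blocks, the objective is a constant plus a sum of
  functions of the single vectors \<open>x $ i\<close>, and the minimization splits over the nodes
  (\<open>radmm_x_step\<close>). Induction over time then identifies the trajectories.
\<close>

section \<open>Minimizers of extended-real functions\<close>

lemma argmin_on_iff:
  "x \<in> argmin_on S h \<longleftrightarrow> x \<in> S \<and> h x < \<infinity> \<and> (\<forall>y\<in>S. h x \<le> h y)"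
  unfolding argmin_on_def is_arg_min_def by (auto simp: not_less)

lemma argmin_on_add_const: "argmin_on S (\<lambda>x. h x + ereal c) = argmin_on S h"
proof -
  have "a + ereal c \<le> b + ereal c \<longleftrightarrow> a \<le> b" and "a + ereal c < \<infinity> \<longleftrightarrow> a < \<infinity>" for a b
    by (cases a; cases b; simp)+
  then show ?thesis
    by (auto simp: argmin_on_iff)
qed

lemma argmin_on_unique:
  assumes "x \<in> S" "h x < \<infinity>" "\<And>y. y \<in> S \<Longrightarrow> y \<noteq> x \<Longrightarrow> h x < h y"
  shows "argmin_on S h = {x}"
proof (intro equalityI subsetI)
  fix y
  assume "y \<in> argmin_on S h"
  then have "y \<in> S" "h y \<le> h x"
    using assms(1) by (auto simp: argmin_on_iff)
  then show "y \<in> {x}"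
    using assms(3)[of y] by fastforce
next
  fix y
  assume "y \<in> {x}"
  then show "y \<in> argmin_on S h"
    using assms by (auto simp: argmin_on_iff intro: less_imp_le)
qed

text \<open>
  One component at a time can be exchanged in a minimizer; the other summands are then real
  numbers and cancel. This fails if a summand may be \<open>- \<infinity>\<close>.
\<close>
lemma argmin_on_separable:
  fixes g :: "'v::finite \<Rightarrow> 'b \<Rightarrow> ereal" and x :: "'b ^ 'v"
  assumes proper: "\<And>i u. u \<in> S i \<Longrightarrow> g i u \<noteq> - \<infinity>"
  shows "x \<in> argmin_on {x. \<forall>i. x $ i \<in> S i} (\<lambda>x. \<Sum>i\<in>UNIV. g i (x $ i))
    \<longleftrightarrow> (\<forall>i. x $ i \<in> argmin_on (S i) (g i))"
    (is "?L \<longleftrightarrow> ?R")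
proof
  assume L: ?L
  then have xS: "x $ i \<in> S i" for i
    by (simp add: argmin_on_iff)
  have "(\<Sum>i\<in>UNIV. g i (x $ i)) \<noteq> \<infinity>"
    using L by (simp add: argmin_on_iff)
  then have fin: "g i (x $ i) \<noteq> \<infinity>" for i
    by (auto simp: sum_Pinfty)
  show ?R
  proof
    fix i
    have "g i (x $ i) \<le> g i u" if u: "u \<in> S i" for u
    proof -
      define x' where "x' = (\<chi> j. if j = i then u else x $ j)"
      define R where "R = (\<Sum>j\<in>UNIV - {i}. g j (x $ j))"
      have split: "(\<Sum>j\<in>UNIV. g j (v $ j)) = g i (v $ i) + (\<Sum>j\<in>UNIV - {i}. g j (v $ j))"
        for v :: "'b ^ 'v"
        by (rule sum.remove) auto
      have "(\<Sum>j\<in>UNIV. g j (x $ j)) \<le> (\<Sum>j\<in>UNIV. g j (x' $ j))"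
      proof -
        have "x' $ j \<in> S j" for j
          using u xS by (simp add: x'_def)
        then show ?thesis
          using L by (simp add: argmin_on_iff)
      qed
      moreover have "(\<Sum>j\<in>UNIV - {i}. g j (x' $ j)) = R"
        unfolding R_def by (rule sum.cong) (auto simp: x'_def)
      ultimately have le: "g i (x $ i) + R \<le> g i u + R"
        using split[of x] split[of x'] by (simp add: x'_def R_def)
      have "R = (\<Sum>j\<in>UNIV - {i}. ereal (real_of_ereal (g j (x $ j))))"
        unfolding R_def using fin proper[OF xS] by (intro sum.cong) (auto simp: ereal_real)
      then obtain r where "R = ereal r"
        by (simp add: sum_ereal)
      with le show ?thesis
        by (cases "g i (x $ i)"; cases "g i u") auto
    qed
    then show "x $ i \<in> argmin_on (S i) (g i)"
      using xS[of i] fin[of i] by (simp add: argmin_on_iff)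
  qed
next
  assume ?R
  then show ?L
    by (auto simp: argmin_on_iff sum_Pinfty less_top[symmetric] top_ereal_def intro!: sum_mono)
qed

section \<open>The swap and its two eigenspaces\<close>

lemma P_map_involution [simp]: "P_map (P_map y) = y"
  by (simp add: P_map_def vec_eq_iff)

lemma P_map_add [simp]: "P_map (y + v) = P_map y + P_map v"
  and P_map_diff [simp]: "P_map (y - v) = P_map y - P_map v"
  and P_map_scaleR [simp]: "P_map (c *\<^sub>R y) = c *\<^sub>R P_map y"
  by (simp_all add: P_map_def vec_eq_iff)

lemma P_map_selfadjoint: "P_map y \<bullet> v = y \<bullet> P_map v"
proof -
  have "P_map y \<bullet> v = (\<Sum>i\<in>UNIV. \<Sum>j\<in>UNIV. y $ j $ i \<bullet> v $ i $ j)"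
    by (simp add: P_map_def inner_vec_def)
  also have "\<dots> = (\<Sum>j\<in>UNIV. \<Sum>i\<in>UNIV. y $ j $ i \<bullet> v $ i $ j)"
    by (rule sum.swap)
  also have "\<dots> = y \<bullet> P_map v"
    by (simp add: P_map_def inner_vec_def)
  finally show ?thesis .
qed

text \<open>
  The decomposition of \<open>z\<close> along the eigenspaces of the swap; the symmetric component is
  divided by \<open>\<rho>\<close>, so that \<open>z\<close> is the multiplier plus \<open>\<rho>\<close> times the bridge variable.
\<close>
definition bridge_of :: "real \<Rightarrow> ('n::finite, 'v::finite) bridge \<Rightarrow> ('n, 'v) bridge" where
  "bridge_of \<rho> z = (1 / (2 * \<rho>)) *\<^sub>R (z + P_map z)"

definition multiplier_of :: "('n::finite, 'v::finite) bridge \<Rightarrow> ('n, 'v) bridge" where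
  "multiplier_of z = (1 / 2) *\<^sub>R (z - P_map z)"

lemma P_map_bridge_of [simp]: "P_map (bridge_of \<rho> z) = bridge_of \<rho> z"
  by (simp add: bridge_of_def add.commute)

lemma scaleR_bridge_of: "\<rho> \<noteq> 0 \<Longrightarrow> \<rho> *\<^sub>R bridge_of \<rho> z = (1 / 2) *\<^sub>R (z + P_map z)"
  by (simp add: bridge_of_def)

lemma multiplier_plus_bridge:
  "\<rho> \<noteq> 0 \<Longrightarrow> multiplier_of z + \<rho> *\<^sub>R bridge_of \<rho> z = z"
  by (simp add: scaleR_bridge_of multiplier_of_def vec_eq_iff field_simps)

lemma P_map_eq_bridge_minus_multiplier:
  "\<rho> \<noteq> 0 \<Longrightarrow> P_map z = \<rho> *\<^sub>R bridge_of \<rho> z - multiplier_of z"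
  by (simp add: scaleR_bridge_of multiplier_of_def vec_eq_iff field_simps)

lemma bridge_of_eq:
  assumes "\<rho> \<noteq> 0" "P_map y = y" "P_map w = - w"
  shows "bridge_of \<rho> (w + \<rho> *\<^sub>R y) = y"
  using assms by (simp add: bridge_of_def vec_eq_iff)

lemma multiplier_of_eq:
  assumes "P_map y = y" "P_map w = - w"
  shows "multiplier_of (w + \<rho> *\<^sub>R y) = w"
  using assms by (simp add: multiplier_of_def vec_eq_iff)

lemma bridge_space_add: "y \<in> bridge_space E \<Longrightarrow> v \<in> bridge_space E \<Longrightarrow> y + v \<in> bridge_space E"
  and bridge_space_diff: "y \<in> bridge_space E \<Longrightarrow> v \<in> bridge_space E \<Longrightarrow> y - v \<in> bridge_space E"
  and bridge_space_scaleR: "y \<in> bridge_space E \<Longrightarrow> c *\<^sub>R y \<in> bridge_space E"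
  and bridge_space_A_map: "A_map E x \<in> bridge_space E"
  by (auto simp: bridge_space_def A_map_def)

text \<open>The block \<open>(i, j), l\<close> exists iff \<open>(j, i), l\<close> does, because the graph is undirected.\<close>
lemma bridge_space_P_map: "sym E \<Longrightarrow> y \<in> bridge_space E \<Longrightarrow> P_map y \<in> bridge_space E"
  by (auto simp: bridge_space_def P_map_def nbrs_def dest: symD)

lemmas bridge_space_intros =
  bridge_space_add bridge_space_diff bridge_space_scaleR bridge_space_A_map bridge_space_P_map

lemma bridge_space_eqI:
  assumes "y \<in> bridge_space E" "v \<in> bridge_space E"
    and "\<And>i j l. j \<in> nbrs E i \<Longrightarrow> l \<in> {i, j} \<Longrightarrow> y $ i $ j $ l = v $ i $ j $ l"
  shows "y = v"
proof -
  have "y $ i $ j $ l = v $ i $ j $ l" for i j l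
    using assms by (cases "j \<in> nbrs E i \<and> l \<in> {i, j}") (auto simp: bridge_space_def)
  then show ?thesis
    by (simp add: vec_eq_iff)
qed

section \<open>The bridge and multiplier steps\<close>

lemma total_cost_finite:
  assumes "\<And>i. proper_fun_on (local_space E i) (f i)"
    and "x \<in> copies_space E" "total_cost f x < \<infinity>"
  shows "\<bar>total_cost f x\<bar> \<noteq> \<infinity>"
  using assms
  by (auto simp: total_cost_def copies_space_def proper_fun_on_def sum_Inf sum_Pinfty)

text \<open>
  On the fixed space of the swap, \<open>v \<bullet> g\<close> only sees the symmetric component of \<open>g\<close>. Hence the
  objective is a constant plus \<open>\<rho> / 2\<close> times the squared distance from \<open>bridge_of \<rho> g\<close>.
\<close>
lemma y_step_argmin:
  fixes w y :: "('n::finite, 'v::finite) bridge" and \<alpha> :: real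
  assumes "sym E" "\<rho> > 0" "\<bar>total_cost f x\<bar> \<noteq> \<infinity>"
    and "y \<in> bridge_space E" "w \<in> bridge_space E"
  defines "g \<equiv> w - \<rho> *\<^sub>R A_map E x - (\<rho> * (2 * \<alpha> - 1)) *\<^sub>R (A_map E x + y)"
  shows "argmin_on (bridge_space E)
      (\<lambda>v. aug_lagrangian E f \<rho> x v w + ereal (\<rho> * (2 * \<alpha> - 1) * (v \<bullet> (A_map E x + y))))
    = {bridge_of \<rho> g}"
proof -
  define a where "a = A_map E x"
  define b where "b = bridge_of \<rho> g"
  obtain c where c: "total_cost f x = ereal c"
    using assms(3) by auto
  define K where "K = c - w \<bullet> a + \<rho> / 2 * (a \<bullet> a) - \<rho> / 2 * (b \<bullet> b)"
  define h where "h = (\<lambda>v. aug_lagrangian E f \<rho> x v w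
    + ereal (\<rho> * (2 * \<alpha> - 1) * (v \<bullet> (A_map E x + y))))"
  have b_space: "b \<in> bridge_space E"
    unfolding b_def bridge_of_def g_def using assms(1,4,5) by (intro bridge_space_intros)
  have h_sym: "h v = ereal (K + \<rho> / 2 * (norm (v - b))\<^sup>2)" if v: "P_map v = v" for v
  proof -
    have "v \<bullet> P_map g = v \<bullet> g"
      using P_map_selfadjoint[of v g] v by simp
    then have "\<rho> * (v \<bullet> b) = v \<bullet> g"
      using \<open>\<rho> > 0\<close> by (simp add: b_def bridge_of_def inner_add_right)
    then have vb: "\<rho> * (v \<bullet> b) = v \<bullet> w - \<rho> * (v \<bullet> a) - \<rho> * (2 * \<alpha> - 1) * (v \<bullet> (a + y))"
      by (simp add: g_def a_def inner_diff_right)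
    have "\<rho> / 2 * (norm (v - b))\<^sup>2 = \<rho> / 2 * (v \<bullet> v) - \<rho> * (v \<bullet> b) + \<rho> / 2 * (b \<bullet> b)"
      by (simp add: power2_norm_eq_inner inner_diff inner_commute algebra_simps)
    moreover have "\<rho> / 2 * (norm (a + v))\<^sup>2 = \<rho> / 2 * (a \<bullet> a) + \<rho> * (v \<bullet> a) + \<rho> / 2 * (v \<bullet> v)"
      by (simp add: power2_norm_eq_inner inner_add inner_commute algebra_simps)
    ultimately have "c - w \<bullet> (a + v) + \<rho> / 2 * (norm (a + v))\<^sup>2
        + \<rho> * (2 * \<alpha> - 1) * (v \<bullet> (a + y)) = K + \<rho> / 2 * (norm (v - b))\<^sup>2"
      using vb unfolding K_def inner_add_right[of w] inner_commute[of v w] by linarith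
    then show ?thesis
      using v by (simp add: h_def aug_lagrangian_def iota_def c a_def)
  qed
  have h_nonsym: "h v = \<infinity>" if "P_map v \<noteq> v" for v
    using that by (simp add: h_def aug_lagrangian_def iota_def c)
  have hb: "h b = ereal K"
    using h_sym[of b] by (simp add: b_def)
  have "h b < h v" if "v \<noteq> b" for v
    using that hb h_sym[of v] h_nonsym[of v] \<open>\<rho> > 0\<close> by (cases "P_map v = v") auto
  then have "argmin_on (bridge_space E) h = {b}"
    using b_space hb by (intro argmin_on_unique) auto
  then show ?thesis
    by (simp add: h_def b_def)
qed

text \<open>
  The relation \<open>z_update\<close> as a function. The sign in the last term is opposite because the blocks
  of \<open>A x\<close> are the negated copies.
\<close>
definition next_z where
  "next_z E \<rho> \<alpha> x z = (1 - \<alpha>) *\<^sub>R z - \<alpha> *\<^sub>R P_map z - (2 * \<alpha> * \<rho>) *\<^sub>R A_map E x"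

lemma next_z_in_bridge_space:
  "sym E \<Longrightarrow> z \<in> bridge_space E \<Longrightarrow> next_z E \<rho> \<alpha> x z \<in> bridge_space E"
  unfolding next_z_def by (intro bridge_space_intros)

lemma z_update_iff:
  assumes "sym E" "z \<in> bridge_space E" "z' \<in> bridge_space E"
  shows "z_update E \<rho> \<alpha> x z z' \<longleftrightarrow> z' = next_z E \<rho> \<alpha> x z"
proof
  assume upd: "z_update E \<rho> \<alpha> x z z'"
  show "z' = next_z E \<rho> \<alpha> x z"
    using upd
    by (intro bridge_space_eqI[OF assms(3) next_z_in_bridge_space[OF assms(1,2)]])
      (auto simp: z_update_def next_z_def P_map_def A_map_def)
next
  assume "z' = next_z E \<rho> \<alpha> x z"
  then show "z_update E \<rho> \<alpha> x z z'"
    by (simp add: z_update_def next_z_def P_map_def A_map_def)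
qed

text \<open>
  For \<open>y\<close> and \<open>w\<close> obtained from \<open>z\<close>, the vector whose symmetric component the \<open>y\<close>-step
  selects is exactly \<open>next_z E \<rho> \<alpha> x z\<close>, and the multiplier step subtracts that component.
\<close>
lemma radmm_yw_step:
  fixes z :: "('n::finite, 'v::finite) bridge" and \<alpha> :: real
  assumes "sym E" "\<rho> > 0" "\<bar>total_cost f x\<bar> \<noteq> \<infinity>" "z \<in> bridge_space E"
  defines "y \<equiv> bridge_of \<rho> z" and "w \<equiv> multiplier_of z" and "z' \<equiv> next_z E \<rho> \<alpha> x z"
  shows "y' \<in> argmin_on (bridge_space E)
        (\<lambda>v. aug_lagrangian E f \<rho> x v w + ereal (\<rho> * (2 * \<alpha> - 1) * (v \<bullet> (A_map E x + y)))) \<and>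
      w' = w - \<rho> *\<^sub>R (A_map E x + y') - (\<rho> * (2 * \<alpha> - 1)) *\<^sub>R (A_map E x + y)
    \<longleftrightarrow> y' = bridge_of \<rho> z' \<and> w' = multiplier_of z'"
proof -
  have yw_space: "y \<in> bridge_space E" "w \<in> bridge_space E"
    unfolding y_def w_def bridge_of_def multiplier_of_def
    by (intro bridge_space_intros assms(1,4))+
  have z: "z = w + \<rho> *\<^sub>R y" and Pz: "P_map z = \<rho> *\<^sub>R y - w"
    using \<open>\<rho> > 0\<close>
    by (simp_all add: y_def w_def multiplier_plus_bridge P_map_eq_bridge_minus_multiplier)
  have g: "w - \<rho> *\<^sub>R A_map E x - (\<rho> * (2 * \<alpha> - 1)) *\<^sub>R (A_map E x + y) = z'"
    unfolding z'_def next_z_def Pz unfolding z by (simp add: vec_eq_iff algebra_simps)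
  have "w - \<rho> *\<^sub>R (A_map E x + bridge_of \<rho> z') - (\<rho> * (2 * \<alpha> - 1)) *\<^sub>R (A_map E x + y)
      = z' - \<rho> *\<^sub>R bridge_of \<rho> z'"
    unfolding g[symmetric] by (simp add: algebra_simps)
  also have "\<dots> = multiplier_of z'"
    using multiplier_plus_bridge[of \<rho> z'] \<open>\<rho> > 0\<close> by (simp add: diff_eq_eq)
  finally show ?thesis
    using y_step_argmin[OF assms(1-3) yw_space, of \<alpha>] g by auto
qed

section \<open>The node step\<close>

text \<open>
  Irreflexivity enters here: with a loop the two lower indices of a block pair would coincide.
\<close>
lemma sum_bridge_blocks:
  fixes \<phi> :: "'v::finite \<Rightarrow> 'v \<Rightarrow> 'v \<Rightarrow> real"
  assumes "irrefl E"
  shows "(\<Sum>i\<in>UNIV. \<Sum>j\<in>UNIV. \<Sum>l\<in>UNIV. if j \<in> nbrs E i \<and> l \<in> {i, j} then \<phi> i j l else 0)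
    = (\<Sum>i\<in>UNIV. \<Sum>j\<in>nbrs E i. \<phi> i j i + \<phi> i j j)"
proof (rule sum.cong[OF refl])
  fix i
  have inner: "(\<Sum>l\<in>UNIV. if j \<in> nbrs E i \<and> l \<in> {i, j} then \<phi> i j l else 0)
      = (if j \<in> nbrs E i then \<phi> i j i + \<phi> i j j else 0)" for j
  proof (cases "j \<in> nbrs E i")
    case True
    then have "i \<noteq> j"
      using assms by (auto simp: nbrs_def irrefl_def)
    have "(\<Sum>l\<in>UNIV. if l \<in> {i, j} then \<phi> i j l else 0) = (\<Sum>l\<in>{i, j}. \<phi> i j l)"
      by (subst sum.inter_restrict[symmetric]) auto
    then show ?thesis
      using True \<open>i \<noteq> j\<close> by simp
  qed simp
  show "(\<Sum>j\<in>UNIV. \<Sum>l\<in>UNIV. if j \<in> nbrs E i \<and> l \<in> {i, j} then \<phi> i j l else 0)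
      = (\<Sum>j\<in>nbrs E i. \<phi> i j i + \<phi> i j j)"
    unfolding inner by (subst sum.inter_restrict[symmetric]) auto
qed

lemma inner_A_map:
  assumes "irrefl E"
  shows "y \<bullet> A_map E x
    = - (\<Sum>i\<in>UNIV. \<Sum>j\<in>nbrs E i. y $ i $ j $ i \<bullet> x $ i $ i + y $ i $ j $ j \<bullet> x $ i $ j)"
proof -
  have "y \<bullet> A_map E x = (\<Sum>i\<in>UNIV. \<Sum>j\<in>UNIV. \<Sum>l\<in>UNIV.
      if j \<in> nbrs E i \<and> l \<in> {i, j} then - (y $ i $ j $ l \<bullet> x $ i $ l) else 0)"
    unfolding inner_vec_def[of y] inner_vec_def[of "y $ _"] inner_vec_def[of "y $ _ $ _"]
    by (intro sum.cong refl) (auto simp: A_map_def)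
  then show ?thesis
    by (simp add: sum_bridge_blocks[OF assms] sum_negf[symmetric] algebra_simps
        del: insert_iff)
qed

lemma norm_A_map:
  assumes "irrefl E"
  shows "(norm (A_map E x))\<^sup>2
    = (\<Sum>i\<in>UNIV. \<Sum>j\<in>nbrs E i. (norm (x $ i $ i))\<^sup>2 + (norm (x $ i $ j))\<^sup>2)"
proof -
  have "A_map E x $ i $ j $ l = - (x $ i $ l)" if "j \<in> nbrs E i" "l \<in> {i, j}" for i j l
    using that by (simp add: A_map_def)
  then show ?thesis
    unfolding power2_norm_eq_inner
    by (simp add: inner_A_map[OF assms] sum_negf[symmetric] power2_norm_eq_inner add.commute)
qed

text \<open>
  The cross terms of the augmented Lagrangian combine to \<open>(\<rho> y - w) \<bullet> A u = P z \<bullet> A u\<close>; the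
  swap is the reason that node \<open>i\<close> uses the blocks of \<open>z\<close> with upper index \<open>(j, i)\<close>.
\<close>
lemma aug_lagrangian_eq_sum_local_objective:
  fixes z :: "('n::finite, 'v::finite) bridge"
  assumes "irrefl E" "\<rho> > 0"
  defines "y \<equiv> bridge_of \<rho> z" and "w \<equiv> multiplier_of z"
  shows "aug_lagrangian E f \<rho> u y w
    = (\<Sum>i\<in>UNIV. local_objective E f \<rho> z i (u $ i)) + ereal (- (w \<bullet> y) + \<rho> / 2 * (norm y)\<^sup>2)"
proof -
  define q where "q i = - ((\<Sum>j\<in>nbrs E i. z $ j $ i $ i) \<bullet> (u $ i $ i))
       - (\<Sum>j\<in>nbrs E i. (z $ j $ i $ j) \<bullet> (u $ i $ j))
       + \<rho> / 2 * real (card (nbrs E i)) * (norm (u $ i $ i))\<^sup>2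
       + \<rho> / 2 * (\<Sum>j\<in>nbrs E i. (norm (u $ i $ j))\<^sup>2)" for i
  have Pz: "P_map z = \<rho> *\<^sub>R y - w"
    using \<open>\<rho> > 0\<close> by (simp add: y_def w_def P_map_eq_bridge_minus_multiplier)
  have "- (w \<bullet> (A_map E u + y)) + \<rho> / 2 * (norm (A_map E u + y))\<^sup>2
      = P_map z \<bullet> A_map E u + \<rho> / 2 * (norm (A_map E u))\<^sup>2
        + (- (w \<bullet> y) + \<rho> / 2 * (norm y)\<^sup>2)"
    unfolding Pz by (simp add: power2_norm_eq_inner inner_add inner_diff inner_commute algebra_simps)
  also have "P_map z \<bullet> A_map E u + \<rho> / 2 * (norm (A_map E u))\<^sup>2 = (\<Sum>i\<in>UNIV. q i)"
    unfolding inner_A_map[OF assms(1)] norm_A_map[OF assms(1)] q_def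
    by (simp add: P_map_def sum.distrib sum_negf sum_subtractf sum_distrib_left inner_sum_left
        algebra_simps)
  finally have quad: "- (w \<bullet> (A_map E u + y)) + \<rho> / 2 * (norm (A_map E u + y))\<^sup>2
      = (\<Sum>i\<in>UNIV. q i) + (- (w \<bullet> y) + \<rho> / 2 * (norm y)\<^sup>2)" .
  have "local_objective E f \<rho> z i (u $ i) = f i (u $ i) + ereal (q i)" for i
    by (simp only: local_objective_def q_def)
  then have "(\<Sum>i\<in>UNIV. local_objective E f \<rho> z i (u $ i))
      = total_cost f u + ereal (\<Sum>i\<in>UNIV. q i)"
    by (simp add: total_cost_def sum.distrib)
  moreover have "iota y = 0"
    by (simp add: iota_def y_def)
  ultimately show ?thesis
    unfolding aug_lagrangian_def quad by (simp add: add.assoc)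
qed

lemma radmm_x_step:
  assumes "irrefl E" "\<rho> > 0" "\<And>i. proper_fun_on (local_space E i) (f i)"
  shows "x \<in> argmin_on (copies_space E)
      (\<lambda>u. aug_lagrangian E f \<rho> u (bridge_of \<rho> z) (multiplier_of z))
    \<longleftrightarrow> local_x_update E f \<rho> z x"
proof -
  have "local_objective E f \<rho> z i u \<noteq> - \<infinity>" if "u \<in> local_space E i" for i u
    using assms(3)[of i] that by (auto simp: proper_fun_on_def local_objective_def)
  note separable = argmin_on_separable[of "local_space E" "local_objective E f \<rho> z", OF this]
  show ?thesis
    unfolding aug_lagrangian_eq_sum_local_objective[OF assms(1,2)] argmin_on_add_const
    by (simp only: copies_space_def separable local_x_update_def)
qed

lemma local_x_update_feasible:
  assumes "local_x_update E f \<rho> z x"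
  shows "x \<in> copies_space E" "total_cost f x < \<infinity>"
proof -
  have min: "x $ i \<in> local_space E i" "local_objective E f \<rho> z i (x $ i) < \<infinity>" for i
    using assms by (auto simp: local_x_update_def argmin_on_iff)
  then show "x \<in> copies_space E"
    by (simp add: copies_space_def)
  have "f i (x $ i) \<noteq> \<infinity>" for i
    using min(2)[of i] by (auto simp: local_objective_def)
  then show "total_cost f x < \<infinity>"
    by (auto simp: total_cost_def sum_Pinfty less_top[symmetric] top_ereal_def)
qed

section \<open>Equality of the trajectories\<close>

text \<open>
  Feasibility of the current copies has to be carried along: it makes \<open>total_cost f (x k)\<close>
  finite, without which the next \<open>y\<close>-step would have no minimizer.
\<close>
lemma radmm_step:
  fixes z :: "('n::finite, 'v::finite) bridge" and \<alpha> :: real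
  assumes "undirected_graph E" "\<rho> > 0" "\<And>i. proper_fun_on (local_space E i) (f i)"
    and "x \<in> copies_space E" "total_cost f x < \<infinity>" "z \<in> bridge_space E"
  defines "z' \<equiv> next_z E \<rho> \<alpha> x z"
  shows "y' \<in> argmin_on (bridge_space E)
        (\<lambda>v. aug_lagrangian E f \<rho> x v (multiplier_of z)
          + ereal (\<rho> * (2 * \<alpha> - 1) * (v \<bullet> (A_map E x + bridge_of \<rho> z)))) \<and>
      w' = multiplier_of z - \<rho> *\<^sub>R (A_map E x + y')
          - (\<rho> * (2 * \<alpha> - 1)) *\<^sub>R (A_map E x + bridge_of \<rho> z) \<and>
      x' \<in> argmin_on (copies_space E) (\<lambda>u. aug_lagrangian E f \<rho> u y' w')
    \<longleftrightarrow> y' = bridge_of \<rho> z' \<and> w' = multiplier_of z' \<and> local_x_update E f \<rho> z' x'"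
proof -
  have E: "sym E" "irrefl E"
    using assms(1) by (auto simp: undirected_graph_def)
  note yw = radmm_yw_step[OF E(1) assms(2) total_cost_finite[OF assms(3-5)] assms(6),
      of y' \<alpha> w', folded z'_def]
  note x = radmm_x_step[OF E(2) assms(2,3), of x' z']
  show ?thesis
    unfolding conj_assoc[symmetric] yw using x by auto
qed

lemma radmm_trajectories_eq_node_trajectories:
  assumes graph: "undirected_graph E" and rho: "\<rho> > 0"
    and proper: "\<And>i. proper_fun_on (local_space E i) (f i)"
    and x0: "x0 \<in> copies_space E" "total_cost f x0 < \<infinity>"
    and y0: "y0 \<in> bridge_space E" "P_map y0 = y0"
    and w0: "w0 \<in> bridge_space E" "P_map w0 = - w0"
  shows "radmm_trajectories E f \<rho> \<alpha> x0 w0 y0 = node_trajectories 1 E f \<rho> \<alpha> x0 w0 y0"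
proof -
  have E: "sym E"
    using graph by (simp add: undirected_graph_def)
  note step = radmm_step[OF graph rho proper]
  define z0 where "z0 = w0 + \<rho> *\<^sub>R y0"
  have z0: "z0 \<in> bridge_space E"
    unfolding z0_def using y0 w0 by (intro bridge_space_intros)
  have y0_eq: "y0 = bridge_of \<rho> z0" and w0_eq: "w0 = multiplier_of z0"
    using rho y0 w0 by (simp_all add: z0_def bridge_of_eq multiplier_of_eq)
  show ?thesis
  proof (intro equalityI subsetI)
    fix x
    assume "x \<in> radmm_trajectories E f \<rho> \<alpha> x0 w0 y0"
    then obtain y w where init: "x 0 = x0" "w 0 = w0" "y 0 = y0" and radmm: "radmm E f \<rho> \<alpha> x y w"
      by (auto simp: radmm_trajectories_def)
    define z where "z = rec_nat z0 (\<lambda>k. next_z E \<rho> \<alpha> (x k))"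
    have z_rec: "z 0 = z0" "z (Suc k) = next_z E \<rho> \<alpha> (x k) (z k)" for k
      by (simp_all add: z_def)
    have z_space: "z k \<in> bridge_space E" for k
      by (induction k) (auto simp: z_rec z0 E next_z_in_bridge_space)
    have step': "y (Suc k) = bridge_of \<rho> (z (Suc k)) \<and> w (Suc k) = multiplier_of (z (Suc k))
        \<and> local_x_update E f \<rho> (z (Suc k)) (x (Suc k))"
      if "y k = bridge_of \<rho> (z k)" "w k = multiplier_of (z k)"
        "x k \<in> copies_space E" "total_cost f (x k) < \<infinity>" for k
      using radmm[unfolded radmm_def, rule_format, of k]
      unfolding that(1,2) step[OF that(3,4) z_space] z_rec .
    have inv: "y k = bridge_of \<rho> (z k) \<and> w k = multiplier_of (z k)
        \<and> x k \<in> copies_space E \<and> total_cost f (x k) < \<infinity>" for k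
    proof (induction k)
      case 0
      then show ?case
        using init x0 y0_eq w0_eq by (simp add: z_rec)
    next
      case (Suc k)
      then show ?case
        using step'[of k] local_x_update_feasible by blast
    qed
    have "local_x_update E f \<rho> (z k) (x k)" if "k \<ge> 1" for k
      using that step'[of "k - 1"] inv[of "k - 1"] by simp
    moreover have "z_update E \<rho> \<alpha> (x k) (z k) (z (Suc k))" for k
      unfolding z_update_iff[OF E z_space z_space] by (rule z_rec)
    ultimately show "x \<in> node_trajectories 1 E f \<rho> \<alpha> x0 w0 y0"
      unfolding node_trajectories_def using init z_space
      by (auto simp: z_rec z0_def intro!: exI[of _ z])
  next
    fix x
    assume "x \<in> node_trajectories 1 E f \<rho> \<alpha> x0 w0 y0"
    then obtain z where x_init: "x 0 = x0" and z_space: "\<And>k. z k \<in> bridge_space E"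
      and z_init: "\<And>i j l. j \<in> nbrs E i \<Longrightarrow> l \<in> {i, j} \<Longrightarrow>
          z 0 $ i $ j $ l = w0 $ i $ j $ l + \<rho> *\<^sub>R (y0 $ i $ j $ l)"
      and x_upd: "\<And>k. k \<ge> 1 \<Longrightarrow> local_x_update E f \<rho> (z k) (x k)"
      and z_upd: "\<And>k. z_update E \<rho> \<alpha> (x k) (z k) (z (Suc k))"
      unfolding node_trajectories_def by blast
    have "z 0 = z0"
      using z_init by (intro bridge_space_eqI[OF z_space z0]) (auto simp: z0_def)
    have z_rec: "z (Suc k) = next_z E \<rho> \<alpha> (x k) (z k)" for k
      using z_update_iff[OF E z_space z_space] z_upd by blast
    have feasible: "x k \<in> copies_space E" "total_cost f (x k) < \<infinity>" for k
      using x0 x_init local_x_update_feasible[OF x_upd[of k]] by (cases k; simp)+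
    have "radmm E f \<rho> \<alpha> x (\<lambda>k. bridge_of \<rho> (z k)) (\<lambda>k. multiplier_of (z k))"
      unfolding radmm_def step[OF feasible z_space] using x_upd by (simp flip: z_rec)
    then show "x \<in> radmm_trajectories E f \<rho> \<alpha> x0 w0 y0"
      unfolding radmm_trajectories_def using x_init \<open>z 0 = z0\<close> y0_eq w0_eq by auto
  qed
qed

text \<open>
  Imposing the minimization at time \<open>0\<close> as well only constrains \<open>x0\<close> and \<open>z 0\<close>, both of which
  are prescribed.
\<close>
lemma node_trajectories_0_eq_1:
  assumes space: "y0 \<in> bridge_space E" "w0 \<in> bridge_space E"
    and x0: "local_x_update E f \<rho> (w0 + \<rho> *\<^sub>R y0) x0"
  shows "node_trajectories 0 E f \<rho> \<alpha> x0 w0 y0 = node_trajectories 1 E f \<rho> \<alpha> x0 w0 y0"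
proof -
  have z0: "w0 + \<rho> *\<^sub>R y0 \<in> bridge_space E"
    using space by (intro bridge_space_intros)
  have z_init: "z = w0 + \<rho> *\<^sub>R y0"
    if "z \<in> bridge_space E" and "\<forall>i. \<forall>j\<in>nbrs E i. \<forall>l\<in>{i, j}.
      z $ i $ j $ l = w0 $ i $ j $ l + \<rho> *\<^sub>R (y0 $ i $ j $ l)" for z
    using that by (intro bridge_space_eqI[OF _ z0]) auto
  have from_1: "\<forall>k\<ge>0. local_x_update E f \<rho> (z k) (x k)"
    if x_init: "x 0 = x0" and "z 0 \<in> bridge_space E"
      and "\<forall>i. \<forall>j\<in>nbrs E i. \<forall>l\<in>{i, j}.
        z 0 $ i $ j $ l = w0 $ i $ j $ l + \<rho> *\<^sub>R (y0 $ i $ j $ l)"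
      and upd: "\<forall>k\<ge>1. local_x_update E f \<rho> (z k) (x k)" for x z :: "nat \<Rightarrow> _"
  proof (intro allI impI)
    fix k :: nat
    show "local_x_update E f \<rho> (z k) (x k)"
      using x0 x_init z_init[OF that(2,3)] upd by (cases k) auto
  qed
  show ?thesis
  proof (intro equalityI subsetI)
    fix x
    assume "x \<in> node_trajectories 0 E f \<rho> \<alpha> x0 w0 y0"
    then show "x \<in> node_trajectories 1 E f \<rho> \<alpha> x0 w0 y0"
      unfolding node_trajectories_def by blast
  next
    fix x
    assume "x \<in> node_trajectories 1 E f \<rho> \<alpha> x0 w0 y0"
    then obtain z where z: "x 0 = x0" "\<forall>k. z k \<in> bridge_space E"
      "\<forall>i. \<forall>j\<in>nbrs E i. \<forall>l\<in>{i, j}.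
        z 0 $ i $ j $ l = w0 $ i $ j $ l + \<rho> *\<^sub>R (y0 $ i $ j $ l)"
      "\<forall>k\<ge>1. local_x_update E f \<rho> (z k) (x k)"
      "\<forall>k. z_update E \<rho> \<alpha> (x k) (z k) (z (Suc k))"
      unfolding node_trajectories_def mem_Collect_eq by (elim exE conjE) (rule that)
    then show "x \<in> node_trajectories 0 E f \<rho> \<alpha> x0 w0 y0"
      unfolding node_trajectories_def mem_Collect_eq
      by (intro exI[of _ z] conjI from_1) (simp_all only: z)
  qed
qed

theorem proposition1:
  fixes E :: "('v::finite \<times> 'v) set"
    and f :: "'v \<Rightarrow> ('n::finite, 'v) local_vec \<Rightarrow> ereal"
    and \<rho> \<alpha> :: real
    and x0 :: "('n, 'v) copies"
    and w0 y0 :: "('n, 'v) bridge"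
  assumes graph: "undirected_graph E"
    and f_closed: "\<And>i. closed_fun_on (local_space E i) (f i)"
    and f_proper: "\<And>i. proper_fun_on (local_space E i) (f i)"
    and f_convex: "\<And>i. convex_fun_on (local_space E i) (f i)"
    and rho_pos: "\<rho> > 0"
    and solvable: "solutions E f \<noteq> {}"
    and x0: "x0 \<in> copies_space E" "total_cost f x0 < \<infinity>"
    and y0: "y0 \<in> bridge_space E" "P_map y0 = y0"
    and w0: "w0 \<in> bridge_space E" "P_map w0 = - w0"
  shows "radmm_trajectories E f \<rho> \<alpha> x0 w0 y0 = node_trajectories 1 E f \<rho> \<alpha> x0 w0 y0
    \<and> (x0 \<in> argmin_on (copies_space E) (\<lambda>u. aug_lagrangian E f \<rho> u y0 w0)
        \<longrightarrow> radmm_trajectories E f \<rho> \<alpha> x0 w0 y0 = node_trajectories 0 E f \<rho> \<alpha> x0 w0 y0)"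
proof -
  have eq: "radmm_trajectories E f \<rho> \<alpha> x0 w0 y0 = node_trajectories 1 E f \<rho> \<alpha> x0 w0 y0"
    by (rule radmm_trajectories_eq_node_trajectories[OF graph rho_pos f_proper x0 y0 w0])
  moreover have "node_trajectories 0 E f \<rho> \<alpha> x0 w0 y0 = node_trajectories 1 E f \<rho> \<alpha> x0 w0 y0"
    if "x0 \<in> argmin_on (copies_space E) (\<lambda>u. aug_lagrangian E f \<rho> u y0 w0)"
  proof (rule node_trajectories_0_eq_1[OF y0(1) w0(1)])
    have "irrefl E"
      using graph by (simp add: undirected_graph_def)
    then show "local_x_update E f \<rho> (w0 + \<rho> *\<^sub>R y0) x0"
      using radmm_x_step[OF _ rho_pos f_proper, of x0 "w0 + \<rho> *\<^sub>R y0"] that rho_pos y0 w0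
      by (simp add: bridge_of_eq multiplier_of_eq)
  qed
  ultimately show ?thesis
    by simp
qed

end
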